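(* Let $\bullet$ denote the one-vertex graph. Then $\lambda_{chr}(\bullet)=1$; and if $G$ is a connected graph, $G\neq\bullet$, then $$\lambda_{chr}(G)=\sum_{\mathcal{F}\in\mathbb{F}(G)}(-1)^{\sharp\mathcal{F}},$$ where $\mathbb{F}(G)$ is the set of forests of $G$.
   Context: A graph is a pair $G=(V(G),E(G))$ with $V(G)$ a finite set and $E(G)$ a set of $2$-element subsets of $V(G)$. The empty graph is considered as non connected. For $I\subseteq V(G)$, $G_{|I}$ is the induced subgraph on $I$. For any graph $G$, $P_{chr}(G)\in\mathbb{Q}[X]$ is the chromatic polynomial: for $k\geq1$, $P_{chr}(G)(k)$ is the number of maps $f:V(G)\to\{1,\ldots,k\}$ with $f(x)\neq f(y)$ for every edge $\{x,y\}$. For $G$ connected, $\lambda_{chr}(G)=\frac{dP_{chr}(G)}{dX}(0)$. Let $G$ be a connected graph, $G\neq\bullet$. A forest of $G$ is a set $\mathcal{F}$ of subsets of $V(G)$ such that: (a) $V(G)\in\mathcal{F}$; (b) if $I,J\in\mathcal{F}$, then $I\subseteq J$ or $J\subseteq I$ or $I\cap J=\emptyset$; (c) for all $I\in\mathcal{F}$, $G_{|I}$ is connected and is not $\bullet$. *)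

theory Defs
  imports "HOL-Library.FuncSet" "HOL-Computational_Algebra.Polynomial"
begin

type_synonym 'a graph = "'a set \<times> 'a set set"

abbreviation verts :: "'a graph \<Rightarrow> 'a set" where "verts G \<equiv> fst G"

abbreviation edges :: "'a graph \<Rightarrow> 'a set set" where "edges G \<equiv> snd G"

definition is_graph :: "'a graph \<Rightarrow> bool" where
  "is_graph G \<longleftrightarrow> finite (verts G) \<and> (\<forall>e\<in>edges G. e \<subseteq> verts G \<and> card e = 2)"

definition induced :: "'a graph \<Rightarrow> 'a set \<Rightarrow> 'a graph" where
  "induced G I = (I, {e \<in> edges G. e \<subseteq> I})"

definition graph_connected :: "'a graph \<Rightarrow> bool" where
  "graph_connected G \<longleftrightarrow> verts G \<noteq> {} \<and>
    (\<forall>x\<in>verts G. \<forall>y\<in>verts G. (x, y) \<in> {(u, v). {u, v} \<in> edges G}\<^sup>*)"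

text \<open>The one-vertex graph is only determined up to isomorphism, hence the parameter of
  \<open>bullet\<close>; \<open>is_bullet\<close> means isomorphic to it.\<close>

definition bullet :: "'a \<Rightarrow> 'a graph" where
  "bullet x = ({x}, {})"

definition is_bullet :: "'a graph \<Rightarrow> bool" where
  "is_bullet G \<longleftrightarrow> (\<exists>x. G = bullet x)"

definition colourings :: "'a graph \<Rightarrow> nat set \<Rightarrow> ('a \<Rightarrow> nat) set" where
  "colourings G C = {f \<in> verts G \<rightarrow>\<^sub>E C. \<forall>x y. {x, y} \<in> edges G \<longrightarrow> f x \<noteq> f y}"

text \<open>That this polynomial exists and is unique is \<open>chromatic_poly_ex1\<close> below.\<close>

definition chromatic_poly :: "'a graph \<Rightarrow> rat poly" where
  "chromatic_poly G =
    (THE p. \<forall>k\<ge>1. poly p (of_nat k) = of_nat (card (colourings G {1..k})))"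

definition lambda_chr :: "'a graph \<Rightarrow> rat" where
  "lambda_chr G = poly (pderiv (chromatic_poly G)) 0"

definition forests :: "'a graph \<Rightarrow> 'a set set set" where
  "forests G = {F. F \<subseteq> Pow (verts G) \<and> verts G \<in> F \<and>
    (\<forall>I\<in>F. \<forall>J\<in>F. I \<subseteq> J \<or> J \<subseteq> I \<or> I \<inter> J = {}) \<and>
    (\<forall>I\<in>F. graph_connected (induced G I) \<and> \<not> is_bullet (induced G I))}"

lemma card_surj_colourings_le:
  assumes G: "is_graph G" and h: "bij_betw h S T"
    and fin: "finite T"
  shows "card {f \<in> colourings G S. f ` verts G = S} \<le> card {f \<in> colourings G T. f ` verts G = T}"
proof (rule card_inj_on_le)
  let ?V = "verts G"
  let ?c = "\<lambda>f. restrict (h \<circ> f) ?V"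
  show "inj_on ?c {f \<in> colourings G S. f ` ?V = S}"
  proof (rule inj_onI)
    fix f g assume f: "f \<in> {f \<in> colourings G S. f ` ?V = S}"
      and g: "g \<in> {f \<in> colourings G S. f ` ?V = S}" and e: "?c f = ?c g"
    have "f x = g x" if x: "x \<in> ?V" for x
    proof -
      have "h (f x) = h (g x)" using fun_cong[OF e, of x] x by simp
      then show ?thesis using f g x h by (auto simp: bij_betw_def inj_on_def)
    qed
    moreover have "f \<in> extensional ?V" "g \<in> extensional ?V"
      using f g by (auto simp: colourings_def PiE_def)
    ultimately show "f = g" by (rule extensionalityI[rotated 2])
  qed
  show "?c ` {f \<in> colourings G S. f ` ?V = S} \<subseteq> {f \<in> colourings G T. f ` ?V = T}"
  proof (rule image_subsetI)
    fix f assume f: "f \<in> {f \<in> colourings G S. f ` ?V = S}"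
    have im: "?c f ` ?V = T" using f h by (auto simp: bij_betw_def)
    then have "?c f \<in> ?V \<rightarrow>\<^sub>E T" by auto
    moreover have "?c f x \<noteq> ?c f y" if "{x, y} \<in> edges G" for x y
    proof -
      have xy: "x \<in> ?V" "y \<in> ?V" using G that by (auto simp: is_graph_def)
      moreover have "f x \<noteq> f y" using f that by (auto simp: colourings_def)
      ultimately show ?thesis using f h by (auto simp: bij_betw_def inj_on_def)
    qed
    ultimately show "?c f \<in> {f \<in> colourings G T. f ` ?V = T}"
      using im by (auto simp: colourings_def)
  qed
  have "colourings G T \<subseteq> ?V \<rightarrow>\<^sub>E T" by (auto simp: colourings_def)
  then show "finite {f \<in> colourings G T. f ` ?V = T}"
    using G fin by (auto simp: is_graph_def intro!: finite_PiE dest: finite_subset)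
qed

text \<open>Classifying colourings by the set of colours used gives
  \<open>P(k) = (\<Sum>j\<le>|V|. c\<^sub>j * (k choose j))\<close>.\<close>

lemma card_colourings:
  assumes G: "is_graph G"
  shows "card (colourings G {1..k}) =
    (\<Sum>j\<le>card (verts G). card {f \<in> colourings G {1..j}. f ` verts G = {1..j}} * (k choose j))"
proof -
  let ?V = "verts G"
  let ?A = "\<lambda>S. {f \<in> colourings G S. f ` ?V = S}"
  have finV: "finite ?V" using G by (simp add: is_graph_def)
  have fin: "finite (colourings G S)" if "finite S" for S
    using finite_subset[of "colourings G S" "?V \<rightarrow>\<^sub>E S"] finV that
    by (auto simp: colourings_def intro!: finite_PiE)
  have A: "card (?A S) = card (?A {1..card S})" if "finite S" for S
  proof -
    obtain h where h: "bij_betw h S {1..card S}"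
      using finite_same_card_bij[of S "{1..card S}"] \<open>finite S\<close> by auto
    show ?thesis
      using card_surj_colourings_le[OF G h] that
        card_surj_colourings_le[OF G bij_betw_inv_into[OF h]] by auto
  qed
  have zero: "?A {1..j} = {}" if "j > card ?V" for j
  proof -
    have "f ` ?V \<noteq> {1..j}" for f :: "'a \<Rightarrow> nat"
      using that card_image_le[OF finV, of f] by auto
    then show ?thesis by blast
  qed
  have "colourings G {1..k} = (\<Union>S\<in>Pow {1..k}. ?A S)"
    by (auto simp: colourings_def PiE_def)
  then have "card (colourings G {1..k}) = (\<Sum>S\<in>Pow {1..k}. card (?A S))"
    by (simp, subst card_UN_disjoint) (auto intro: fin finite_subset)
  also have "\<dots> = (\<Sum>S\<in>Pow {1..k}. card (?A {1..card S}))"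
    by (intro sum.cong refl A) (auto intro: finite_subset)
  also have "\<dots> = (\<Sum>j\<le>k. \<Sum>S\<in>{S\<in>Pow {1..k}. card S = j}. card (?A {1..card S}))"
    by (rule sum.group[symmetric]) (auto dest!: card_mono[rotated])
  also have "\<dots> = (\<Sum>j\<le>k. card (?A {1..j}) * (k choose j))"
  proof (rule sum.cong[OF refl])
    fix j
    have "card {S \<in> Pow {1..k}. card S = j} = k choose j"
      using n_subsets[of "{1..k}" j] by simp
    then show "(\<Sum>S\<in>{S\<in>Pow {1..k}. card S = j}. card (?A {1..card S})) =
        card (?A {1..j}) * (k choose j)" by simp
  qed
  also have "\<dots> = (\<Sum>j\<le>k + card ?V. card (?A {1..j}) * (k choose j))"
    by (rule sum.mono_neutral_left) auto
  also have "\<dots> = (\<Sum>j\<le>card ?V. card (?A {1..j}) * (k choose j))"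
  proof (rule sum.mono_neutral_right)
    show "\<forall>j\<in>{..k + card ?V} - {..card ?V}. card (?A {1..j}) * (k choose j) = 0"
    proof
      fix j assume "j \<in> {..k + card ?V} - {..card ?V}"
      then have "?A {1..j} = {}" by (intro zero) auto
      then show "card (?A {1..j}) * (k choose j) = 0" by (simp only: card.empty mult_0)
    qed
  qed auto
  finally show ?thesis .
qed

lemma chromatic_poly_ex1:
  assumes G: "is_graph G"
  shows "\<exists>!p :: rat poly. \<forall>k\<ge>1. poly p (of_nat k) = of_nat (card (colourings G {1..k}))"
proof (rule ex_ex1I)
  define c :: "nat \<Rightarrow> rat" where
    "c j = of_nat (card {f \<in> colourings G {1..j}. f ` verts G = {1..j}})" for j
  let ?p = "\<Sum>j\<le>card (verts G). smult (c j / fact j) (\<Prod>i<j. [:- of_nat i, 1:])"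
  have "poly ?p (of_nat k) = of_nat (card (colourings G {1..k}))" for k
    unfolding card_colourings[OF G, of k]
    by (simp add: poly_sum poly_prod c_def binomial_gbinomial gbinomial_prod_rev
        lessThan_atLeast0)
  then show "\<exists>p :: rat poly. \<forall>k\<ge>1. poly p (of_nat k) = of_nat (card (colourings G {1..k}))"
    by blast
next
  fix p q :: "rat poly"
  assume p: "\<forall>k\<ge>1. poly p (of_nat k) = of_nat (card (colourings G {1..k}))"
    and q: "\<forall>k\<ge>1. poly q (of_nat k) = of_nat (card (colourings G {1..k}))"
  have "of_nat ` {1..} \<subseteq> {x. poly (p - q) x = 0}" using p q by auto
  moreover have "infinite (of_nat ` {1..} :: rat set)"
    by (subst finite_image_iff) (auto simp: inj_on_def infinite_Ici)
  ultimately have "p - q = 0" using poly_roots_finite finite_subset by blast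
  then show "p = q" by simp
qed

end

theory Submission
  imports Defs "HOL-Combinatorics.Transposition"
begin

text \<open>
  For a fixed vertex \<open>v\<close>, the two sides of the identity satisfy the same recursion. Say that a
  function \<open>g\<close> on vertex sets is good if, for every vertex set \<open>S\<close> containing \<open>v\<close>,
  the sum of \<open>g B\<close> over all \<open>B\<close> with \<open>v \<in> B \<subseteq> S\<close> and \<open>S - B\<close> independent is \<open>1\<close> if \<open>S\<close> is
  independent and \<open>0\<close> otherwise. The term \<open>B = S\<close> always occurs in this sum, so a good function
  is determined by induction on \<open>S\<close> (\<open>recursion_unique\<close>).

  Forests are good. Let \<open>T S\<close> be the sum of \<open>(-1)^card F\<close> over all laminar families \<open>F\<close> of tubes
  (connected vertex sets other than single vertices) inside \<open>S\<close>; the members of \<open>F\<close> need not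
  include \<open>S\<close>. If \<open>S\<close> contains an edge, a maximal tube in \<open>S\<close> is nested with or disjoint from
  every other tube in \<open>S\<close>, and adding or removing it cancels the sum; hence \<open>T S\<close> is \<open>1\<close> or \<open>0\<close>
  according to whether \<open>S\<close> is independent (\<open>signed_count_tubes\<close>). On the other hand, splitting
  the families according to their largest member \<open>B\<close> containing \<open>v\<close>, with \<open>B = {v}\<close> if there is
  none, writes \<open>T S\<close> as the sum of products of the forest count of \<open>B\<close> and \<open>T (S - B)\<close>
  (\<open>signed_count_rec\<close>). Together these are the recursion (\<open>rooted_forests_rec\<close>).

  Chromatic polynomials are good. Count the colourings of \<open>S\<close> with colours \<open>1, \<dots>, k + 1\<close> in which
  \<open>v\<close> does not get the last colour. By symmetry of the colours they make up the fraction
  \<open>k / (k + 1)\<close> of all colourings; sorting them by the set \<open>B\<close> of vertices that avoid the last colour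
  gives the sum of \<open>P\<^sub>B(k)\<close>, where \<open>P\<^sub>B\<close> is the chromatic polynomial of the graph induced on \<open>B\<close>.
  Hence \<open>(X + 1) * (\<Sum>B. P\<^sub>B(X)) = X * P\<^sub>S(X + 1)\<close>. Setting
  \<open>X = -1\<close> shows \<open>P\<^sub>S(0) = 0\<close>, and then differentiating at \<open>0\<close> gives \<open>\<Sum>B. \<lambda>(B) = P\<^sub>S(1)\<close>
  (\<open>lambda_chr_rec\<close>), where \<open>P\<^sub>S(1)\<close> is \<open>1\<close> or \<open>0\<close> according to whether \<open>S\<close> is independent.
\<close>

section \<open>Signed counts of laminar families\<close>

definition laminar :: "'a set set \<Rightarrow> bool" where
  "laminar F \<longleftrightarrow> (\<forall>I\<in>F. \<forall>J\<in>F. I \<subseteq> J \<or> J \<subseteq> I \<or> I \<inter> J = {})"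

definition laminar_families :: "'a set set \<Rightarrow> 'a set \<Rightarrow> 'a set set set" where
  "laminar_families L S = {F. F \<subseteq> L \<inter> Pow S \<and> laminar F}"

definition signed_count :: "'a set set set \<Rightarrow> rat" where
  "signed_count \<F> = (\<Sum>F\<in>\<F>. (- 1) ^ card F)"

lemma finite_laminar_families: "finite S \<Longrightarrow> finite (laminar_families L S)"
  by (rule finite_subset[of _ "Pow (Pow S)"]) (auto simp: laminar_families_def)

lemma finite_laminar_family: "finite S \<Longrightarrow> F \<in> laminar_families L S \<Longrightarrow> finite F"
  by (rule finite_subset[of _ "Pow S"]) (auto simp: laminar_families_def)

text \<open>Toggling the membership of \<open>C\<close> preserves laminarity, because \<open>C\<close> crosses no other
  available set; it is an involution that changes the parity of the cardinality.\<close>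

lemma signed_count_eq_0:
  assumes S: "finite S" and C: "C \<in> L" "C \<subseteq> S"
    and sep: "\<And>J. J \<in> L \<Longrightarrow> J \<subseteq> S \<Longrightarrow> J \<subseteq> C \<or> J \<inter> C = {}"
  shows "signed_count (laminar_families L S) = 0"
proof -
  let ?N = "laminar_families L S"
  define t where "t F = (if C \<in> F then F - {C} else insert C F)" for F
  have tt: "t (t F) = F" for F by (auto simp: t_def)
  have tN: "t F \<in> ?N" if F: "F \<in> ?N" for F
  proof -
    have lam: "laminar F" and sub: "F \<subseteq> L \<inter> Pow S" using F by (auto simp: laminar_families_def)
    have "laminar (insert C F)"
      unfolding laminar_def
    proof (intro ballI)
      fix I J assume "I \<in> insert C F" "J \<in> insert C F"
      moreover have "K \<subseteq> C \<or> K \<inter> C = {}" if "K \<in> F" for K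
        using that sub sep by blast
      ultimately show "I \<subseteq> J \<or> J \<subseteq> I \<or> I \<inter> J = {}"
        using lam unfolding laminar_def by blast
    qed
    moreover have "laminar (F - {C})" using lam by (auto simp: laminar_def)
    ultimately show ?thesis using sub C by (auto simp: t_def laminar_families_def)
  qed
  have sign: "(- 1) ^ card (t F) = - ((- 1) ^ card F :: rat)" if "F \<in> ?N" for F
  proof (cases "C \<in> F")
    case True
    then have "card F = Suc (card (F - {C}))"
      using finite_laminar_family[OF S that] by (metis card_Suc_Diff1)
    then have "(- 1) ^ card F = - ((- 1) ^ card (F - {C}) :: rat)" by (simp only: power_Suc)
    then show ?thesis using True by (simp add: t_def)
  qed (use finite_laminar_family[OF S that] in \<open>simp add: t_def\<close>)
  have "signed_count ?N = (\<Sum>F\<in>?N. (- 1) ^ card (t F))"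
    unfolding signed_count_def
    by (rule sum.reindex_bij_witness[of _ t t]) (auto simp: tt tN)
  also have "\<dots> = - signed_count ?N"
    by (simp add: signed_count_def sign sum_negf)
  finally show ?thesis by simp
qed

text \<open>In a laminar family the sets containing \<open>v\<close> form a chain, so their union is the largest of
  them; inserting \<open>v\<close> makes \<open>{v}\<close> the value when there are none.\<close>

definition top_member :: "'a \<Rightarrow> 'a set set \<Rightarrow> 'a set" where
  "top_member v F = insert v (\<Union>{I \<in> F. v \<in> I})"

lemma top_member_cases:
  assumes "finite F" "laminar F"
  shows "top_member v F = {v} \<or> top_member v F \<in> F"
proof (cases "{I \<in> F. v \<in> I} = {}")
  case True
  then have "top_member v F = {v}" unfolding top_member_def by (simp only: Union_empty)
  then show ?thesis by simp
next
  case False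
  then obtain M where M: "M \<in> F" "v \<in> M" and max: "\<And>I. I \<in> F \<Longrightarrow> v \<in> I \<Longrightarrow> M \<subseteq> I \<Longrightarrow> M = I"
    using finite_has_maximal[of "{I \<in> F. v \<in> I}"] assms(1) by auto
  have "I \<subseteq> M" if "I \<in> F" "v \<in> I" for I
  proof -
    have "I \<subseteq> M \<or> M \<subseteq> I \<or> I \<inter> M = {}" using assms(2) M(1) that(1) by (simp add: laminar_def)
    moreover have "I \<inter> M \<noteq> {}" using M(2) that(2) by auto
    ultimately show ?thesis using max[OF that] by auto
  qed
  then have "\<Union>{I \<in> F. v \<in> I} = M" using M by blast
  then have "top_member v F = M" using M(2) by (auto simp: top_member_def)
  then show ?thesis using M by simp
qed

lemma subset_top_member: "I \<in> F \<Longrightarrow> v \<in> I \<Longrightarrow> I \<subseteq> top_member v F"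
  by (auto simp: top_member_def)

text \<open>For finite \<open>B\<close> containing \<open>v\<close> and other elements these are the laminar families on \<open>B\<close>
  that have \<open>B\<close> as a member, i.e. the forests when \<open>L\<close> consists of the tubes. The definition through \<open>top_member\<close> also covers
  \<open>B = {v}\<close>, where only the empty family remains: this is the value \<open>1\<close> of \<open>\<lambda>\<close> at the one-vertex
  graph.\<close>

definition rooted_families :: "'a set set \<Rightarrow> 'a \<Rightarrow> 'a set \<Rightarrow> 'a set set set" where
  "rooted_families L v B = {F \<in> laminar_families L B. top_member v F = B}"

lemma rooted_families_singleton:
  assumes "{v} \<notin> L" "{} \<notin> L"
  shows "rooted_families L v {v} = {{}}"
proof -
  have "L \<inter> Pow {v} = {}" using assms by (auto simp: subset_singleton_iff)
  then show ?thesis by (auto simp: rooted_families_def laminar_families_def laminar_def top_member_def)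
qed

lemma rooted_families_eq:
  assumes "finite B" "v \<in> B" "B \<noteq> {v}"
  shows "rooted_families L v B = {F \<in> laminar_families L B. B \<in> F}"
proof (intro equalityI subsetI)
  fix F assume "F \<in> rooted_families L v B"
  then show "F \<in> {F \<in> laminar_families L B. B \<in> F}"
    using top_member_cases[of F v] finite_laminar_family[OF assms(1)] assms(3)
    by (auto simp: rooted_families_def laminar_families_def)
next
  fix F assume F: "F \<in> {F \<in> laminar_families L B. B \<in> F}"
  then have "top_member v F = B" using assms(2) by (auto simp: top_member_def laminar_families_def)
  then show "F \<in> rooted_families L v B" using F by (simp add: rooted_families_def)
qed

text \<open>Once the largest member \<open>B\<close> containing \<open>v\<close> is fixed, every other member lies inside \<open>B\<close> or
  is disjoint from it, and the parts inside and outside \<open>B\<close> can be chosen independently.\<close>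

lemma signed_count_top_member:
  assumes S: "finite S" and B: "v \<in> B" "B \<subseteq> S" and L: "{} \<notin> L"
  shows "signed_count {F \<in> laminar_families L S. top_member v F = B} =
    signed_count (rooted_families L v B) * signed_count (laminar_families L (S - B))"
proof -
  let ?R = "rooted_families L v B" and ?N = "laminar_families L (S - B)"
  have split: "I \<subseteq> B \<or> I \<inter> B = {}"
    if F: "F \<in> laminar_families L S" "top_member v F = B" and I: "I \<in> F" for F I
  proof (cases "v \<in> I")
    case True
    then show ?thesis using subset_top_member[OF I True] F(2) by simp
  next
    case False
    have "laminar F" using F by (simp add: laminar_families_def)
    with top_member_cases[OF finite_laminar_family[OF S F(1)], of v] F
    have "B = {v} \<or> B \<in> F" by simp
    then show ?thesis
    proof
      assume "B \<in> F"
      then have "I \<subseteq> B \<or> B \<subseteq> I \<or> I \<inter> B = {}"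
        using \<open>laminar F\<close> I by (simp add: laminar_def)
      moreover have "\<not> B \<subseteq> I" using False B(1) by auto
      ultimately show ?thesis by simp
    qed (use False in simp)
  qed
  have "signed_count {F \<in> laminar_families L S. top_member v F = B} =
      (\<Sum>(F1, F2)\<in>?R \<times> ?N. (- 1) ^ card F1 * (- 1) ^ card F2)"
    unfolding signed_count_def
  proof (rule sum.reindex_bij_witness[of _ "\<lambda>(F1, F2). F1 \<union> F2" "\<lambda>F. (F \<inter> Pow B, F - Pow B)"])
    fix F assume F: "F \<in> {F \<in> laminar_families L S. top_member v F = B}"
    then have N: "F \<in> laminar_families L S" and h: "top_member v F = B" by auto
    show "(case (F \<inter> Pow B, F - Pow B) of (F1, F2) \<Rightarrow> F1 \<union> F2) = F" by auto
    have "top_member v (F \<inter> Pow B) = B"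
    proof -
      have "I \<in> Pow B" if "I \<in> F" "v \<in> I" for I
        using subset_top_member[OF that] unfolding h by simp
      then have "{I \<in> F \<inter> Pow B. v \<in> I} = {I \<in> F. v \<in> I}" by blast
      then have "top_member v (F \<inter> Pow B) = top_member v F" unfolding top_member_def by simp
      then show ?thesis unfolding h .
    qed
    moreover have "F - Pow B \<subseteq> Pow (S - B)"
    proof
      fix I assume I: "I \<in> F - Pow B"
      then have "I \<inter> B = {}" using split[OF N h, of I] by auto
      moreover have "I \<subseteq> S" using I N by (auto simp: laminar_families_def)
      ultimately show "I \<in> Pow (S - B)" by auto
    qed
    moreover have "laminar (F \<inter> Pow B)" "laminar (F - Pow B)" "F \<subseteq> L"
      using N by (simp_all add: laminar_families_def laminar_def)
    ultimately show "(F \<inter> Pow B, F - Pow B) \<in> ?R \<times> ?N"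
      by (auto simp: rooted_families_def laminar_families_def)
    have "card F = card (F \<inter> Pow B) + card (F - Pow B)"
      using finite_laminar_family[OF S N]
      by (metis card_Int_Diff)
    then show "(case (F \<inter> Pow B, F - Pow B) of (F1, F2) \<Rightarrow> (- 1) ^ card F1 * (- 1) ^ card F2) =
        (- 1 :: rat) ^ card F" by (simp add: power_add)
  next
    fix p assume "p \<in> ?R \<times> ?N"
    then obtain F1 F2 where p: "p = (F1, F2)" and F1: "F1 \<in> ?R" and F2: "F2 \<in> ?N" by auto
    have sub1: "F1 \<subseteq> L \<inter> Pow B" and sub2: "F2 \<subseteq> L \<inter> Pow (S - B)"
      and lam: "laminar F1" "laminar F2" and h: "top_member v F1 = B"
      using F1 F2 by (auto simp: rooted_families_def laminar_families_def)
    have cross: "I \<inter> J = {}" if "I \<in> F1" "J \<in> F2" for I J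
      using that sub1 sub2 by blast
    have "I \<subseteq> J \<or> J \<subseteq> I \<or> I \<inter> J = {}" if IJ: "I \<in> F1 \<union> F2" "J \<in> F1 \<union> F2" for I J
    proof -
      consider "I \<in> F1" "J \<in> F1" | "I \<in> F2" "J \<in> F2" | "I \<in> F1" "J \<in> F2" | "I \<in> F2" "J \<in> F1"
        using IJ by blast
      then show ?thesis
      proof cases
        case 4
        then have "J \<inter> I = {}" using cross by simp
        then show ?thesis by auto
      qed (use lam cross in \<open>simp_all add: laminar_def\<close>)
    qed
    then have "laminar (F1 \<union> F2)" unfolding laminar_def by simp
    moreover have "{I \<in> F1 \<union> F2. v \<in> I} = {I \<in> F1. v \<in> I}" using sub2 B by blast
    then have "top_member v (F1 \<union> F2) = top_member v F1" unfolding top_member_def by simp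
    then have "top_member v (F1 \<union> F2) = B" unfolding h .
    moreover have "F1 \<union> F2 \<subseteq> L \<inter> Pow S" using sub1 sub2 B by blast
    ultimately show "(case p of (F1, F2) \<Rightarrow> F1 \<union> F2) \<in> {F \<in> laminar_families L S. top_member v F = B}"
      by (simp add: p laminar_families_def)
    \<comment> \<open>A set inside both \<open>B\<close> and \<open>S - B\<close> is empty: only because \<open>{}\<close> is not in \<open>L\<close> can the two
      parts be recovered from their union.\<close>
    have "F2 \<inter> Pow B \<subseteq> {{}}" using sub2 by blast
    moreover have "{} \<notin> F2" using sub2 L by blast
    ultimately have "F2 \<inter> Pow B = {}" by blast
    moreover have "F1 \<subseteq> Pow B" using sub1 by blast
    ultimately have "(F1 \<union> F2) \<inter> Pow B = F1" "(F1 \<union> F2) - Pow B = F2" by blast+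
    then show "((case p of (F1, F2) \<Rightarrow> F1 \<union> F2) \<inter> Pow B, (case p of (F1, F2) \<Rightarrow> F1 \<union> F2) - Pow B) = p"
      by (simp add: p)
  qed
  also have "\<dots> = signed_count ?R * signed_count ?N"
    unfolding signed_count_def sum_product sum.cartesian_product ..
  finally show ?thesis .
qed

lemma signed_count_rec:
  assumes S: "finite S" "v \<in> S" and L: "{} \<notin> L"
  shows "signed_count (laminar_families L S) =
    (\<Sum>B | v \<in> B \<and> B \<subseteq> S.
      signed_count (rooted_families L v B) * signed_count (laminar_families L (S - B)))"
proof -
  have "top_member v F \<in> {B. v \<in> B \<and> B \<subseteq> S}" if "F \<in> laminar_families L S" for F
    using that S by (auto simp: top_member_def laminar_families_def)
  then have "signed_count (laminar_families L S) =
      (\<Sum>B | v \<in> B \<and> B \<subseteq> S. signed_count {F \<in> laminar_families L S. top_member v F = B})"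
    unfolding signed_count_def
    by (intro sum.group[symmetric] finite_laminar_families S) (auto simp: S)
  also have "\<dots> = (\<Sum>B | v \<in> B \<and> B \<subseteq> S.
      signed_count (rooted_families L v B) * signed_count (laminar_families L (S - B)))"
    by (intro sum.cong refl signed_count_top_member S L) auto
  finally show ?thesis .
qed

section \<open>Tubes of a graph\<close>

text \<open>In a graph these sets consist of vertices automatically, since every element of a connected
  set with at least two elements lies on an edge.\<close>

definition tubes :: "'a graph \<Rightarrow> 'a set set" where
  "tubes G = {I. graph_connected (induced G I) \<and> \<not> is_bullet (induced G I)}"

definition independent_set :: "'a graph \<Rightarrow> 'a set \<Rightarrow> bool" where
  "independent_set G S \<longleftrightarrow> (\<forall>e\<in>edges G. \<not> e \<subseteq> S)"

lemma is_graph_induced: "is_graph G \<Longrightarrow> S \<subseteq> verts G \<Longrightarrow> is_graph (induced G S)"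
  by (auto simp: is_graph_def induced_def dest: finite_subset)

lemma induced_singleton: "is_graph G \<Longrightarrow> induced G {x} = bullet x"
  by (auto simp: is_graph_def induced_def bullet_def subset_singleton_iff)

lemma induced_verts: "is_graph G \<Longrightarrow> induced G (verts G) = G"
  by (auto simp: induced_def is_graph_def prod_eq_iff)

lemma forests_eq_rooted_families:
  assumes "is_graph G" "v \<in> verts G" "\<not> is_bullet G"
  shows "forests G = rooted_families (tubes G) v (verts G)"
proof -
  have "verts G \<noteq> {v}"
  proof
    assume "verts G = {v}"
    then have "induced G {v} = G" using induced_verts[OF assms(1)] by simp
    then show False using assms induced_singleton[OF assms(1), of v] by (auto simp: is_bullet_def)
  qed
  then show ?thesis
    using assms
    by (subst rooted_families_eq)
      (auto simp: is_graph_def forests_def laminar_families_def laminar_def tubes_def)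
qed

lemma tubes_empty: "{} \<notin> tubes G"
  by (simp add: tubes_def graph_connected_def induced_def)

lemma tubes_singleton: "is_graph G \<Longrightarrow> {v} \<notin> tubes G"
  by (auto simp: tubes_def induced_singleton is_bullet_def)

text \<open>Edges supply a tube inside every set that is not independent.\<close>

lemma edge_tube:
  assumes "is_graph G" "e \<in> edges G"
  shows "e \<in> tubes G"
proof -
  obtain x y where e: "e = {x, y}" "x \<noteq> y" using assms by (auto simp: is_graph_def card_2_iff)
  let ?E = "{(u, v). {u, v} \<in> edges (induced G e)}"
  have "{x, y} \<in> edges (induced G e)" using assms e by (simp add: induced_def)
  moreover have "{y, x} = {x, y}" by blast
  ultimately have "(x, y) \<in> ?E" "(y, x) \<in> ?E" by simp_all
  then have "(u, w) \<in> ?E\<^sup>*" if "u \<in> {x, y}" "w \<in> {x, y}" for u w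
    using that by blast
  moreover have "verts (induced G e) = {x, y}" by (simp add: induced_def e)
  ultimately have "graph_connected (induced G e)"
    unfolding graph_connected_def by blast
  moreover have "\<not> is_bullet (induced G e)" using assms by (auto simp: is_bullet_def bullet_def induced_def)
  ultimately show ?thesis by (simp add: tubes_def)
qed

lemma tube_contains_edge:
  assumes "is_graph G" "I \<in> tubes G"
  shows "\<exists>e\<in>edges G. e \<subseteq> I"
proof (rule ccontr)
  assume no: "\<not> ?thesis"
  then have E: "{(u, v). {u, v} \<in> edges (induced G I)} = {}" by (auto simp: induced_def)
  have con: "graph_connected (induced G I)" using assms(2) by (simp add: tubes_def)
  then obtain x where x: "x \<in> I" by (auto simp: graph_connected_def induced_def)
  have "(x, y) \<in> {(u, v). {u, v} \<in> edges (induced G I)}\<^sup>*" if "y \<in> I" for y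
    using con x that by (simp add: graph_connected_def induced_def)
  then have "y = x" if "y \<in> I" for y
    using that unfolding E by simp
  then have "I = {x}" using x by blast
  then show False using assms tubes_singleton[of G x] by simp
qed

text \<open>Through a common vertex any two vertices of the union can be joined. Consequently a maximal
  tube never crosses another one.\<close>

lemma tubes_Un:
  assumes I: "I \<in> tubes G" and J: "J \<in> tubes G" and ne: "I \<inter> J \<noteq> {}" and G: "is_graph G"
  shows "I \<union> J \<in> tubes G"
proof -
  let ?E = "\<lambda>S. {(u, v). {u, v} \<in> edges (induced G S)}"
  obtain z where z: "z \<in> I" "z \<in> J" using ne by blast
  have mono: "(?E S)\<^sup>* \<subseteq> (?E (I \<union> J))\<^sup>*" if "S \<subseteq> I \<union> J" for S
    using that by (intro rtrancl_mono) (auto simp: induced_def)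
  have "(x, z) \<in> (?E (I \<union> J))\<^sup>* \<and> (z, x) \<in> (?E (I \<union> J))\<^sup>*" if "x \<in> I \<union> J" for x
  proof (cases "x \<in> I")
    case True
    then have "(x, z) \<in> (?E I)\<^sup>*" "(z, x) \<in> (?E I)\<^sup>*"
      using I z by (auto simp: tubes_def graph_connected_def induced_def)
    then show ?thesis using mono[of I] by blast
  next
    case False
    then have "(x, z) \<in> (?E J)\<^sup>*" "(z, x) \<in> (?E J)\<^sup>*"
      using J z that by (auto simp: tubes_def graph_connected_def induced_def)
    then show ?thesis using mono[of J] by blast
  qed
  then have "graph_connected (induced G (I \<union> J))"
    using z unfolding graph_connected_def by (auto simp: induced_def intro: rtrancl_trans)
  moreover obtain e where "e \<in> edges G" "e \<subseteq> I" using tube_contains_edge[OF G I] by blast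
  then have "\<not> is_bullet (induced G (I \<union> J))"
    by (auto simp: is_bullet_def bullet_def induced_def)
  ultimately show ?thesis by (simp add: tubes_def)
qed

lemma signed_count_tubes:
  assumes G: "is_graph G" and S: "finite S"
  shows "signed_count (laminar_families (tubes G) S) = of_bool (independent_set G S)"
proof (cases "independent_set G S")
  case True
  have "I \<notin> tubes G" if "I \<subseteq> S" for I
  proof
    assume "I \<in> tubes G"
    then obtain e where "e \<in> edges G" "e \<subseteq> I" using tube_contains_edge[OF G] by blast
    then show False using True \<open>I \<subseteq> S\<close> by (auto simp: independent_set_def)
  qed
  then have "laminar_families (tubes G) S = {{}}"
    by (auto simp: laminar_families_def laminar_def)
  then show ?thesis using True by (simp add: signed_count_def)
next
  case False
  then obtain e where "e \<in> tubes G" "e \<subseteq> S"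
    using edge_tube[OF G] by (auto simp: independent_set_def)
  then have "tubes G \<inter> Pow S \<noteq> {}" by blast
  moreover have "finite (tubes G \<inter> Pow S)" using S by simp
  ultimately have "\<exists>C\<in>tubes G \<inter> Pow S. \<forall>J\<in>tubes G \<inter> Pow S. C \<subseteq> J \<longrightarrow> C = J"
    by (rule finite_has_maximal[rotated])
  then obtain C where C: "C \<in> tubes G" "C \<subseteq> S"
    and max: "\<And>J. J \<in> tubes G \<Longrightarrow> J \<subseteq> S \<Longrightarrow> C \<subseteq> J \<Longrightarrow> C = J"
    by (meson IntD1 IntD2 IntI PowD PowI)
  have "J \<subseteq> C \<or> J \<inter> C = {}" if "J \<in> tubes G" "J \<subseteq> S" for J
  proof (rule disjCI)
    assume "J \<inter> C \<noteq> {}"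
    then have "C \<inter> J \<noteq> {}" by (simp add: Int_commute)
    then have "C \<union> J \<in> tubes G" by (rule tubes_Un[OF C(1) that(1) _ G])
    then have "C = C \<union> J" using max[of "C \<union> J"] C(2) that(2) by simp
    then show "J \<subseteq> C" by (metis Un_upper2)
  qed
  from signed_count_eq_0[OF S C this] show ?thesis using False by simp
qed

text \<open>The left-hand side of \<open>signed_count_rec\<close> and its factors \<open>T (S - B)\<close> are evaluated by
  \<open>signed_count_tubes\<close>; the factors restrict the sum to independent complements.\<close>

lemma rooted_forests_rec:
  assumes G: "is_graph G" and S: "finite S" "v \<in> S"
  shows "(\<Sum>B | v \<in> B \<and> B \<subseteq> S \<and> independent_set G (S - B).
      signed_count (rooted_families (tubes G) v B)) = of_bool (independent_set G S)"
proof -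
  have "of_bool (independent_set G S) = (\<Sum>B | v \<in> B \<and> B \<subseteq> S.
      signed_count (rooted_families (tubes G) v B) * of_bool (independent_set G (S - B)))"
    using signed_count_rec[OF S tubes_empty[of G]] S(1)
    by (simp add: signed_count_tubes[OF G] del: sum_mult_of_bool_eq)
  also have "\<dots> = (\<Sum>B | v \<in> B \<and> B \<subseteq> S \<and> independent_set G (S - B).
      signed_count (rooted_families (tubes G) v B))"
    by (rule sum.mono_neutral_cong_right) (use S in auto)
  finally show ?thesis by simp
qed

section \<open>The chromatic polynomial\<close>

lemma poly_chromatic_poly:
  assumes "is_graph G" "k \<ge> 1"
  shows "poly (chromatic_poly G) (of_nat k) = of_nat (card (colourings G {1..k}))"
  using theI'[OF chromatic_poly_ex1[OF assms(1)]] assms(2)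
  unfolding chromatic_poly_def by blast

lemma finite_colourings: "is_graph G \<Longrightarrow> finite C \<Longrightarrow> finite (colourings G C)"
  by (rule finite_subset[of _ "verts G \<rightarrow>\<^sub>E C"])
    (auto simp: colourings_def is_graph_def intro!: finite_PiE)

text \<open>With a single colour, the only candidate is the constant map.\<close>

lemma poly_chromatic_poly_1:
  assumes G: "is_graph G" and S: "S \<subseteq> verts G"
  shows "poly (chromatic_poly (induced G S)) 1 = of_bool (independent_set G S)"
proof -
  have "colourings (induced G S) {1..1} = (if independent_set G S then {\<lambda>x\<in>S. 1} else {})"
  proof (cases "independent_set G S")
    case True
    then show ?thesis
      by (auto simp: colourings_def induced_def independent_set_def PiE_iff extensional_def fun_eq_iff)
  next
    case False
    then obtain e where e: "e \<in> edges G" "e \<subseteq> S" by (auto simp: independent_set_def)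
    then obtain x y where "e = {x, y}" using G by (auto simp: is_graph_def card_2_iff)
    then have "f \<notin> colourings (induced G S) {1..1}" for f
      using e by (auto simp: colourings_def induced_def PiE_iff)
    then show ?thesis using False by auto
  qed
  then show ?thesis
    using poly_chromatic_poly[OF is_graph_induced[OF G S], of 1] by simp
qed

lemma card_colourings_swap:
  assumes G: "is_graph G" and v: "v \<in> verts G" and C: "finite C" "a \<in> C" "b \<in> C"
  shows "card {f \<in> colourings G C. f v = a} = card {f \<in> colourings G C. f v = b}"
proof -
  have sub: "x \<in> verts G" "y \<in> verts G" if "{x, y} \<in> edges G" for x y
    using G that by (auto simp: is_graph_def)
  have le: "restrict (transpose a b \<circ> f) (verts G) \<in> {f \<in> colourings G C. f v = b}"
    if "f \<in> {f \<in> colourings G C. f v = a}" "a \<in> C" "b \<in> C" for f a b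
    using that v sub
    by (fastforce simp: colourings_def PiE_iff transpose_def)
  have inv: "restrict (transpose b a \<circ> restrict (transpose a b \<circ> f) (verts G)) (verts G) = f"
    if "f \<in> colourings G C" for f a b
    using that by (auto simp: colourings_def fun_eq_iff PiE_iff extensional_def transpose_def)
  show ?thesis
    by (rule bij_betw_same_card[OF bij_betw_byWitness[where
        f = "\<lambda>f. restrict (transpose a b \<circ> f) (verts G)" and
        f' = "\<lambda>f. restrict (transpose b a \<circ> f) (verts G)"]])
      (use le inv C in auto)
qed

text \<open>All \<open>k + 1\<close> colours are taken by \<open>v\<close> equally often, and \<open>k\<close> of them are allowed here.\<close>

lemma card_colourings_root:
  assumes G: "is_graph G" and v: "v \<in> verts G"
  shows "Suc k * card {f \<in> colourings G {1..Suc k}. f v \<noteq> Suc k} = k * card (colourings G {1..Suc k})"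
proof -
  let ?C = "{1..Suc k}"
  let ?A = "\<lambda>j. {f \<in> colourings G ?C. f v = j}"
  have col: "f v \<in> ?C" if "f \<in> colourings G ?C" for f
    using that v by (auto simp: colourings_def PiE_iff)
  have A: "card (?A j) = card (?A 1)" if "j \<in> ?C" for j
    by (rule card_colourings_swap[OF G v]) (use that in auto)
  have fin: "finite (?A j)" for j using finite_colourings[OF G, of ?C] by simp
  have "colourings G ?C = (\<Union>j\<in>?C. ?A j)" using col by auto
  then have "card (colourings G ?C) = card (\<Union>j\<in>?C. ?A j)" by (rule arg_cong)
  also have "\<dots> = (\<Sum>j\<in>?C. card (?A j))"
    by (subst card_UN_disjoint, use fin in auto)
  also have "\<dots> = (\<Sum>j\<in>?C. card (?A 1))" by (intro sum.cong refl A)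
  also have "\<dots> = Suc k * card (?A 1)" by simp
  finally have 1: "card (colourings G ?C) = Suc k * card (?A 1)" .
  have "{f \<in> colourings G ?C. f v \<noteq> Suc k} = (\<Union>j\<in>{1..k}. ?A j)"
    using col by (fastforce simp: le_Suc_eq)
  then have "card {f \<in> colourings G ?C. f v \<noteq> Suc k} = card (\<Union>j\<in>{1..k}. ?A j)"
    by (rule arg_cong)
  also have "\<dots> = (\<Sum>j\<in>{1..k}. card (?A j))"
    by (subst card_UN_disjoint, use fin in auto)
  also have "\<dots> = (\<Sum>j\<in>{1..k}. card (?A 1))" by (intro sum.cong refl A) auto
  also have "\<dots> = k * card (?A 1)" by simp
  finally show ?thesis unfolding 1 by (simp only: mult_ac)
qed

text \<open>The vertices with the last colour form an independent set, and the others are properly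
  coloured with the first \<open>k\<close> colours. Conversely, an edge between the two parts never
  causes a conflict, so the colourings with a given \<open>B\<close> are just those of the graph on \<open>B\<close>.\<close>

lemma card_colourings_split:
  assumes G: "is_graph G" and S: "S \<subseteq> verts G" "v \<in> S"
  shows "card {f \<in> colourings (induced G S) {1..Suc k}. f v \<noteq> Suc k} =
    (\<Sum>B | v \<in> B \<and> B \<subseteq> S \<and> independent_set G (S - B). card (colourings (induced G B) {1..k}))"
proof -
  let ?K = "{f \<in> colourings (induced G S) {1..Suc k}. f v \<noteq> Suc k}"
  let ?I = "{B. v \<in> B \<and> B \<subseteq> S \<and> independent_set G (S - B)}"
  define low where "low f = {x \<in> S. f x \<noteq> Suc k}" for f :: "'a \<Rightarrow> nat"
  have finS: "finite S" using G S by (auto simp: is_graph_def dest: finite_subset)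
  have finK: "finite ?K" using finite_colourings[OF is_graph_induced[OF G S(1)]] by simp
  have lowI: "low f \<in> ?I" if f: "f \<in> ?K" for f
  proof -
    have "\<not> e \<subseteq> S - low f" if e: "e \<in> edges G" for e
    proof
      assume sub: "e \<subseteq> S - low f"
      obtain x y where xy: "e = {x, y}" using G e by (auto simp: is_graph_def card_2_iff)
      then have "f x = Suc k" "f y = Suc k" using sub by (auto simp: low_def)
      moreover have "e \<in> edges (induced G S)" using e sub by (auto simp: induced_def)
      then have "f x \<noteq> f y" using f by (simp add: colourings_def xy)
      ultimately show False by simp
    qed
    then show ?thesis using f S by (auto simp: low_def independent_set_def)
  qed
  have fibre: "card {f \<in> ?K. low f = B} = card (colourings (induced G B) {1..k})"
    if B: "B \<in> ?I" for B
  proof (rule bij_betw_same_card[OF bij_betw_byWitness[where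
        f = "\<lambda>f. restrict f B" and f' = "\<lambda>g. \<lambda>x\<in>S. if x \<in> B then g x else Suc k"]])
    show "\<forall>f\<in>{f \<in> ?K. low f = B}. (\<lambda>x\<in>S. if x \<in> B then restrict f B x else Suc k) = f"
      by (auto simp: colourings_def induced_def low_def fun_eq_iff PiE_iff extensional_def)
    show "\<forall>g\<in>colourings (induced G B) {1..k}.
        restrict (\<lambda>x\<in>S. if x \<in> B then g x else Suc k) B = g"
      using B by (auto simp: colourings_def induced_def fun_eq_iff PiE_iff extensional_def)
    show "(\<lambda>f. restrict f B) ` {f \<in> ?K. low f = B} \<subseteq> colourings (induced G B) {1..k}"
      using B by (fastforce simp: colourings_def induced_def low_def PiE_iff le_Suc_eq)
    show "(\<lambda>g. \<lambda>x\<in>S. if x \<in> B then g x else Suc k) ` colourings (induced G B) {1..k}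
        \<subseteq> {f \<in> ?K. low f = B}"
    proof (rule image_subsetI)
      fix g assume g: "g \<in> colourings (induced G B) {1..k}"
      let ?f = "\<lambda>x\<in>S. if x \<in> B then g x else Suc k"
      have gk: "g x \<in> {1..k}" if "x \<in> B" for x
        using g that by (auto simp: colourings_def induced_def PiE_iff)
      have "?f x \<noteq> ?f y" if "{x, y} \<in> edges G" "{x, y} \<subseteq> S" for x y
      proof -
        have "x \<in> B \<or> y \<in> B" using B that by (auto simp: independent_set_def)
        moreover have "g x \<noteq> g y" if "x \<in> B" "y \<in> B"
          using g that \<open>{x, y} \<in> edges G\<close> by (auto simp: colourings_def induced_def)
        ultimately show ?thesis using gk[of x] gk[of y] that by auto
      qed
      then have "?f \<in> colourings (induced G S) {1..Suc k}"
        using gk by (fastforce simp: colourings_def induced_def)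
      moreover have "low ?f = B"
      proof -
        have "g x \<noteq> Suc k" if "x \<in> B" for x using gk[OF that] by simp
        then show ?thesis using B by (auto simp: low_def)
      qed
      ultimately show "?f \<in> {f \<in> ?K. low f = B}" using B S gk[of v] by auto
    qed
  qed
  have "card ?K = (\<Sum>f\<in>?K. 1)" by simp
  also have "\<dots> = (\<Sum>B\<in>?I. \<Sum>f\<in>{f \<in> ?K. low f = B}. 1)"
    by (rule sum.group[symmetric]) (use finS finK lowI in auto)
  also have "\<dots> = (\<Sum>B\<in>?I. card (colourings (induced G B) {1..k}))"
    using fibre by simp
  finally show ?thesis .
qed

lemma poly_eqI_nat:
  fixes p q :: "rat poly"
  assumes "\<And>k. k \<ge> 1 \<Longrightarrow> poly p (of_nat k) = poly q (of_nat k)"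
  shows "p = q"
proof -
  have "of_nat ` {1..} \<subseteq> {x. poly (p - q) x = 0}" using assms by auto
  moreover have "infinite (of_nat ` {1..} :: rat set)"
    by (subst finite_image_iff) (auto simp: inj_on_def infinite_Ici)
  ultimately have "p - q = 0" using poly_roots_finite finite_subset by blast
  then show ?thesis by simp
qed

text \<open>At \<open>X = k\<close> both sides are \<open>k + 1\<close> times the number of colourings of \<open>S\<close> with \<open>k + 1\<close>
  colours that do not give \<open>v\<close> the last one.\<close>

lemma chromatic_poly_rec:
  assumes G: "is_graph G" and S: "S \<subseteq> verts G" "v \<in> S"
  shows "[:1, 1:] * (\<Sum>B | v \<in> B \<and> B \<subseteq> S \<and> independent_set G (S - B). chromatic_poly (induced G B)) =
    [:0, 1:] * pcompose (chromatic_poly (induced G S)) [:1, 1:]"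
proof (rule poly_eqI_nat)
  fix k :: nat assume k: "k \<ge> 1"
  let ?I = "{B. v \<in> B \<and> B \<subseteq> S \<and> independent_set G (S - B)}"
  have GS: "is_graph (induced G S)" by (rule is_graph_induced[OF G S(1)])
  have "Suc k * (\<Sum>B\<in>?I. card (colourings (induced G B) {1..k})) =
      k * card (colourings (induced G S) {1..Suc k})"
    using card_colourings_root[OF GS, of v k] card_colourings_split[OF G S, of k] S
    by (simp add: induced_def)
  then have "of_nat (Suc k) * (\<Sum>B\<in>?I. of_nat (card (colourings (induced G B) {1..k}))) =
      (of_nat k :: rat) * of_nat (card (colourings (induced G S) {1..Suc k}))"
    by (metis (no_types, lifting) of_nat_mult of_nat_sum sum.cong)
  moreover have "poly (chromatic_poly (induced G B)) (of_nat k) =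
      of_nat (card (colourings (induced G B) {1..k}))" if "B \<in> ?I" for B
    using that S k by (intro poly_chromatic_poly is_graph_induced[OF G]) auto
  moreover have "poly (chromatic_poly (induced G S)) (1 + of_nat k) =
      of_nat (card (colourings (induced G S) {1..Suc k}))"
    using poly_chromatic_poly[OF GS, of "Suc k"] by simp
  ultimately show "poly ([:1, 1:] * (\<Sum>B\<in>?I. chromatic_poly (induced G B))) (of_nat k) =
      poly ([:0, 1:] * pcompose (chromatic_poly (induced G S)) [:1, 1:]) (of_nat k)"
    by (simp add: poly_sum poly_pcompose algebra_simps)
qed

text \<open>At \<open>X = -1\<close> the left-hand side of \<open>chromatic_poly_rec\<close> vanishes and the right-hand side
  is \<open>- P\<^sub>S(0)\<close>.\<close>

lemma poly_chromatic_poly_0: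
  assumes G: "is_graph G" and S: "S \<subseteq> verts G" "v \<in> S"
  shows "poly (chromatic_poly (induced G S)) 0 = 0"
  using arg_cong[OF chromatic_poly_rec[OF assms], of "\<lambda>p. poly p (- 1)"]
  by (simp add: poly_pcompose)

text \<open>Differentiating \<open>chromatic_poly_rec\<close> at \<open>0\<close>, by the product rule, leaves the sum of the values
  at \<open>0\<close>, which vanish, plus the sum of the derivatives on the left, and \<open>P\<^sub>S(1)\<close> on the
  right.\<close>

lemma lambda_chr_rec:
  assumes G: "is_graph G" and S: "S \<subseteq> verts G" "v \<in> S"
  shows "(\<Sum>B | v \<in> B \<and> B \<subseteq> S \<and> independent_set G (S - B). lambda_chr (induced G B)) =
    of_bool (independent_set G S)"
proof -
  let ?I = "{B. v \<in> B \<and> B \<subseteq> S \<and> independent_set G (S - B)}"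
  let ?q = "\<Sum>B\<in>?I. chromatic_poly (induced G B)"
  have "poly ?q 0 = (\<Sum>B\<in>?I. poly (chromatic_poly (induced G B)) 0)" by (simp add: poly_sum)
  also have "\<dots> = 0"
    by (intro sum.neutral ballI poly_chromatic_poly_0[OF G, of _ v]) (use S in auto)
  finally have "poly ?q 0 = 0" .
  then have "poly (pderiv ?q) 0 = poly (chromatic_poly (induced G S)) 1"
    using arg_cong[OF chromatic_poly_rec[OF assms], of "\<lambda>p. poly (pderiv p) 0"]
    by (simp add: pderiv_mult pderiv_pCons poly_pcompose del: mult_pCons_left)
  moreover have "pderiv ?q = (\<Sum>B\<in>?I. pderiv (chromatic_poly (induced G B)))"
    using higher_pderiv_sum[of 1] by simp
  then have "poly (pderiv ?q) 0 = (\<Sum>B\<in>?I. lambda_chr (induced G B))"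
    by (simp add: lambda_chr_def poly_sum)
  ultimately show ?thesis using poly_chromatic_poly_1[OF G S(1)] by simp
qed

section \<open>Comparison of the two recursions\<close>

text \<open>The complement of \<open>B = S\<close> is empty, hence independent, so \<open>g S\<close> occurs in the recursion at
  \<open>S\<close>, while all other terms concern smaller sets.\<close>

lemma recursion_unique:
  fixes g h :: "'a set \<Rightarrow> rat"
  assumes "finite S" "v \<in> S"
    and g: "\<And>T. T \<subseteq> S \<Longrightarrow> v \<in> T \<Longrightarrow> (\<Sum>B | v \<in> B \<and> B \<subseteq> T \<and> independent_set G (T - B). g B) = r T"
    and h: "\<And>T. T \<subseteq> S \<Longrightarrow> v \<in> T \<Longrightarrow> (\<Sum>B | v \<in> B \<and> B \<subseteq> T \<and> independent_set G (T - B). h B) = r T"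
    and ne: "\<forall>e\<in>edges G. e \<noteq> {}"
  shows "g S = h S"
  using assms(1,2) g h
proof (induction S rule: finite_psubset_induct)
  case (psubset S)
  let ?I = "{B. v \<in> B \<and> B \<subseteq> S \<and> independent_set G (S - B)}"
  have fin: "finite ?I" using psubset by auto
  have SI: "S \<in> ?I" using psubset ne by (auto simp: independent_set_def)
  have "g B = h B" if "B \<in> ?I - {S}" for B
    using that psubset.IH[of B] psubset.prems by blast
  then have "sum g (?I - {S}) = sum h (?I - {S})" by simp
  moreover have "sum g ?I = sum h ?I" using psubset.prems by simp
  ultimately show ?case by (simp add: sum.remove[OF fin SI])
qed

lemma lambda_chr_eq_signed_count:
  assumes G: "is_graph G" and v: "v \<in> verts G"
  shows "lambda_chr G = signed_count (rooted_families (tubes G) v (verts G))"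
proof -
  have fin: "finite (verts G)" and ne: "\<forall>e\<in>edges G. e \<noteq> {}"
    using G by (auto simp: is_graph_def)
  have "lambda_chr (induced G (verts G)) = signed_count (rooted_families (tubes G) v (verts G))"
    by (rule recursion_unique[where G = G, OF fin v lambda_chr_rec[OF G]
          rooted_forests_rec[OF G finite_subset[OF _ fin]] ne])
  then show ?thesis by (simp add: induced_verts[OF G])
qed

theorem proposition2p6:
  shows "(\<forall>x :: 'a. lambda_chr (bullet x) = 1) \<and>
    (\<forall>G :: 'a graph. is_graph G \<and> graph_connected G \<and> \<not> is_bullet G \<longrightarrow>
      lambda_chr G = (\<Sum>F\<in>forests G. (- 1) ^ card F))"
proof (intro conjI allI impI)
  fix x :: 'a
  have "is_graph (bullet x)" by (simp add: is_graph_def bullet_def)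
  moreover have "verts (bullet x) = {x}" by (simp add: bullet_def)
  ultimately show "lambda_chr (bullet x) = 1"
    by (simp add: lambda_chr_eq_signed_count[of _ x] rooted_families_singleton tubes_singleton
        tubes_empty signed_count_def)
next
  fix G :: "'a graph"
  assume G: "is_graph G \<and> graph_connected G \<and> \<not> is_bullet G"
  then obtain v where "v \<in> verts G" by (auto simp: graph_connected_def)
  then show "lambda_chr G = (\<Sum>F\<in>forests G. (- 1) ^ card F)"
    using lambda_chr_eq_signed_count[of G v] forests_eq_rooted_families[of G v] G
    by (simp add: signed_count_def)
qed

end
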